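(* There exist a finite MDP $\mathcal{M}=(S,s_1,\mathcal{A},\mathcal{P})$, a non-negative cost function $c:S\times\mathcal{A}\to\mathbb{R}_{\geq 0}$, a discount factor $\beta\in(0,1)$ and a set $B\subseteq S$ of absorbing target states for which no optimal policy exists, i.e., there is no policy $\pi^{\star}\in\Xi(\mathcal{M},B)$ with $$J(\pi^{\star})=\inf_{\pi\in\Xi(\mathcal{M},B)}J(\pi).$$
   Context: A Markov decision process (MDP) is a tuple $\mathcal{M}=(S,s_1,\mathcal{A},\mathcal{P})$ with $S$ a finite set of states, $s_1\in S$ an initial state, $\mathcal{A}$ a finite set of actions, $\mathcal{A}(s)\subseteq\mathcal{A}$ the (nonempty) set of actions available in $s$, and $\mathcal{P}:S\times\mathcal{A}\times S\to[0,1]$ with $\sum_{s'\in S}\mathcal{P}_{s,a,s'}=1$ for all $s\in S$, $a\in\mathcal{A}(s)$, where $\mathcal{P}_{s,a,s'}=\mathcal{P}(s,a,s')$. A state $s$ is absorbing if $\mathcal{P}_{s,a,s}=1$ for all $a\in\mathcal{A}(s)$. A policy is a sequence $\pi=(d_1,d_2,\ldots)$ of maps $d_t:S\times\mathcal{A}\to[0,1]$ with $\sum_{a\in\mathcal{A}(s)}d_t(s,a)=1$ for all $s$ (at step $t$ in state $s$ the agent takes action $a\in\mathcal{A}(s)$ with probability $d_t(s,a)$); $\Pi(\mathcal{M})$ is the set of all policies. A policy generates random paths $s_1s_2s_3\ldots$ with actions $a_1,a_2,\ldots$, and $\Pr^{\pi}_{\mathcal{M}}(Reach[B])$ is the probability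 that $s_t\in B$ for some $t\geq 1$. The set $\Xi(\mathcal{M},B)\subseteq\Pi(\mathcal{M})$ consists of the policies attaining $\max_{\pi\in\Pi(\mathcal{M})}\Pr^{\pi}_{\mathcal{M}}(Reach[B])$ (this maximum exists). The cost-to-go is $J(\pi)=\mathbb{E}^{\pi}\big[\sum_{t=1}^{\infty}\beta^{t-1}c(s_t,a_t)\big]$. *)

theory Defs
  imports "HOL-Probability.Probability"
begin

record ('s, 'a) mdp =
  states :: "'s set"
  init :: 's
  actions :: "'a set"
  avail :: "'s \<Rightarrow> 'a set"
  trans_prob :: "'s \<Rightarrow> 'a \<Rightarrow> 's \<Rightarrow> real"

definition finite_mdp :: "('s, 'a) mdp \<Rightarrow> bool" where
  "finite_mdp M \<longleftrightarrow>
     finite (states M) \<and> init M \<in> states M \<and> finite (actions M) \<and>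
     (\<forall>s\<in>states M. avail M s \<subseteq> actions M \<and> avail M s \<noteq> {}) \<and>
     (\<forall>s\<in>states M. \<forall>a\<in>actions M. \<forall>s'\<in>states M. trans_prob M s a s' \<in> {0..1}) \<and>
     (\<forall>s\<in>states M. \<forall>a\<in>avail M s. (\<Sum>s'\<in>states M. trans_prob M s a s') = 1)"

definition absorbing :: "('s, 'a) mdp \<Rightarrow> 's \<Rightarrow> bool" where
  "absorbing M s \<longleftrightarrow> (\<forall>a\<in>avail M s. trans_prob M s a s = 1)"

(* Steps are counted from 0, so d 0 is the decision rule at the initial state. *)
type_synonym ('s, 'a) policy = "nat \<Rightarrow> 's \<Rightarrow> 'a \<Rightarrow> real"

definition policies :: "('s, 'a) mdp \<Rightarrow> ('s, 'a) policy set" where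
  "policies M = {d. \<forall>t. \<forall>s\<in>states M.
     (\<forall>a\<in>actions M. d t s a \<in> {0..1}) \<and> (\<Sum>a\<in>avail M s. d t s a) = 1}"

(* The two distributions below are specified by their mass functions only for s in states M,
   a in avail M s and d in policies M (see the two pmf lemmas); other arguments
   occur with probability 0. *)
definition action_pmf :: "('s, 'a) mdp \<Rightarrow> ('s, 'a) policy \<Rightarrow> nat \<Rightarrow> 's \<Rightarrow> 'a pmf" where
  "action_pmf M d t s = embed_pmf (\<lambda>a. if a \<in> avail M s then d t s a else 0)"

definition next_pmf :: "('s, 'a) mdp \<Rightarrow> 's \<Rightarrow> 'a \<Rightarrow> 's pmf" where
  "next_pmf M s a = embed_pmf (\<lambda>s'. if s' \<in> states M then trans_prob M s a s' else 0)"

(* Distribution of the state-action pair at step t, given the pairs w 0, ..., w (t - 1). *)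
definition step_pmf ::
  "('s, 'a) mdp \<Rightarrow> ('s, 'a) policy \<Rightarrow> nat \<Rightarrow> (nat \<Rightarrow> 's \<times> 'a) \<Rightarrow> ('s \<times> 'a) pmf" where
  "step_pmf M d t w =
     bind_pmf (case t of 0 \<Rightarrow> return_pmf (init M) | Suc n \<Rightarrow> next_pmf M (fst (w n)) (snd (w n)))
       (\<lambda>s. map_pmf (Pair s) (action_pmf M d t s))"

(* The Ionescu-Tulcea measure on infinite sequences of state-action pairs; lemma
   Ionescu_Tulcea_step_pmf shows that the locale defining it applies. *)
definition path_measure :: "('s, 'a) mdp \<Rightarrow> ('s, 'a) policy \<Rightarrow> (nat \<Rightarrow> 's \<times> 'a) measure" where
  "path_measure M d =
     projective_family.lim UNIV
       (Ionescu_Tulcea.CI (\<lambda>t w. measure_pmf (step_pmf M d t w)) (\<lambda>_. count_space UNIV))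
       (\<lambda>_. count_space UNIV)"

definition reach_prob :: "('s, 'a) mdp \<Rightarrow> 's set \<Rightarrow> ('s, 'a) policy \<Rightarrow> real" where
  "reach_prob M B d =
     measure (path_measure M d) {w \<in> space (path_measure M d). \<exists>t. fst (w t) \<in> B}"

definition max_reach_policies :: "('s, 'a) mdp \<Rightarrow> 's set \<Rightarrow> ('s, 'a) policy set" where
  "max_reach_policies M B =
     {d \<in> policies M. \<forall>d'\<in>policies M. reach_prob M B d' \<le> reach_prob M B d}"

(* The exponent of \<beta> is t rather than t - 1 because steps are counted from 0. *)
definition cost_to_go ::
  "('s, 'a) mdp \<Rightarrow> ('s \<Rightarrow> 'a \<Rightarrow> real) \<Rightarrow> real \<Rightarrow> ('s, 'a) policy \<Rightarrow> real" where
  "cost_to_go M c \<beta> d = (\<integral>w. (\<Sum>t. \<beta> ^ t * c (fst (w t)) (snd (w t))) \<partial>path_measure M d)"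

lemma pmf_embed_finite:
  assumes "finite A" "\<And>x. x \<in> A \<Longrightarrow> f x \<ge> 0" "sum f A = 1"
  shows "pmf (embed_pmf (\<lambda>x. if x \<in> A then f x else 0)) x = (if x \<in> A then f x else 0)"
proof (rule pmf_embed_pmf)
  have "(\<integral>\<^sup>+x. ennreal (if x \<in> A then f x else 0) \<partial>count_space UNIV) =
        (\<Sum>x\<in>A. ennreal (if x \<in> A then f x else 0))"
    by (rule nn_integral_count_space'[OF assms(1)]) auto
  also have "\<dots> = (\<Sum>x\<in>A. ennreal (f x))" by (rule sum.cong) auto
  also have "\<dots> = ennreal (sum f A)" by (rule sum_ennreal) (use assms in auto)
  finally show "(\<integral>\<^sup>+x. ennreal (if x \<in> A then f x else 0) \<partial>count_space UNIV) = 1"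
    using assms(3) by simp
qed (use assms in auto)

lemma pmf_next_pmf:
  assumes "finite_mdp M" "s \<in> states M" "a \<in> avail M s"
  shows "pmf (next_pmf M s a) s' = (if s' \<in> states M then trans_prob M s a s' else 0)"
proof -
  have "a \<in> actions M" using assms by (auto simp: finite_mdp_def)
  with assms show ?thesis
    unfolding next_pmf_def by (intro pmf_embed_finite) (auto simp: finite_mdp_def)
qed

lemma pmf_action_pmf:
  assumes "finite_mdp M" "d \<in> policies M" "s \<in> states M"
  shows "pmf (action_pmf M d t s) a = (if a \<in> avail M s then d t s a else 0)"
proof -
  have *: "avail M s \<subseteq> actions M" "finite (actions M)" using assms by (auto simp: finite_mdp_def)
  show ?thesis
    unfolding action_pmf_def
  proof (rule pmf_embed_finite)
    show "finite (avail M s)" using * finite_subset by blast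
  next
    fix a assume "a \<in> avail M s"
    then show "d t s a \<ge> 0" using assms * by (force simp: policies_def)
  next
    show "(\<Sum>a\<in>avail M s. d t s a) = 1" using assms by (auto simp: policies_def)
  qed
qed

lemma Ionescu_Tulcea_step_pmf:
  "Ionescu_Tulcea (\<lambda>t w. measure_pmf (step_pmf M d t w)) (\<lambda>_. count_space UNIV)"
proof
  fix t
  show "(\<lambda>w. measure_pmf (step_pmf M d t w))
    \<in> (\<Pi>\<^sub>M i\<in>{0..<t}. count_space UNIV) \<rightarrow>\<^sub>M subprob_algebra (count_space UNIV)"
  proof (cases t)
    case 0
    then show ?thesis
      by (simp add: step_pmf_def measure_pmf_in_subprob_algebra)
  next
    case (Suc n)
    let ?K = "\<lambda>p. measure_pmf (bind_pmf (next_pmf M (fst p) (snd p))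
      (\<lambda>s. map_pmf (Pair s) (action_pmf M d (Suc n) s)))"
    have "?K \<in> count_space UNIV \<rightarrow>\<^sub>M subprob_algebra (count_space UNIV)"
      by (auto intro: measure_pmf_in_subprob_algebra)
    moreover have "(\<lambda>w. w n) \<in> (\<Pi>\<^sub>M i\<in>{0..<t}. count_space UNIV) \<rightarrow>\<^sub>M count_space UNIV"
      using Suc by (intro measurable_component_singleton) auto
    ultimately have "(\<lambda>w. ?K (w n)) \<in> (\<Pi>\<^sub>M i\<in>{0..<t}. count_space UNIV) \<rightarrow>\<^sub>M
        subprob_algebra (count_space UNIV)"
      by (rule measurable_compose[rotated])
    then show ?thesis
      using Suc by (simp add: step_pmf_def)
  qed
qed

end

(* In the initial state 0 one may wait for free or move to the absorbing target 1, where each step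
   costs 1. Every policy reaching the target almost surely therefore has positive cost, whereas
   moving after n waiting steps has cost (1/2)^n for the discount factor 1/2; hence the infimum
   over the policies maximising the reachability probability is 0 and is not attained. *)

theory Submission
  imports Defs
begin

section \<open>Ionescu-Tulcea measures\<close>

context Ionescu_Tulcea
begin

text \<open>The total mass is read off at the empty index set: the cylinder over \<open>{}\<close>
  is the whole space, and \<open>CI {}\<close> is a probability measure.\<close>

lemma prob_space_lim: "prob_space PF.lim"
proof
  have "emeasure PF.lim (PF.emb UNIV {} (space (PiM {} M))) = CI {} (space (PiM {} M))"
    by (rule lim) auto
  moreover have "PF.emb UNIV {} (space (PiM {} M)) = space PF.lim"
    by (auto simp: prod_emb_def space_PiM)
  moreover have "CI {} (space (PiM {} M)) = 1"
    using prob_space.emeasure_space_1[OF PF.prob_space_P[of "{}"]] by (simp add: PF.space_P)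
  ultimately show "emeasure PF.lim (space PF.lim) = 1"
    by simp
qed

text \<open>Each kernel needs to be a point mass only after the history given by \<open>p\<close>
  itself: by induction that history carries all the mass, so other histories never matter.\<close>

lemma C_deterministic:
  assumes p: "\<And>i. p i \<in> space (M i)"
    and det: "\<And>i. P i (restrict p {0..<i}) = return (M i) (p i)"
  shows "C 0 n (\<lambda>_. undefined) = return (PiM {0..<n} M) (restrict p {0..<n})"
proof (induction n)
  case 0
  then show ?case by (simp add: restrict_def)
next
  case (Suc n)
  have r: "restrict p {0..<n} \<in> space (PiM {0..<n} M)"
    using p by (auto simp: space_PiM)
  have [measurable]: "fun_upd (restrict p {0..<n}) n \<in> M n \<rightarrow>\<^sub>M PiM {0..<Suc n} M"
    by (rule measurable_fun_upd[where J = "{0..<n}"]) (use r in auto)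
  \<comment> \<open>Binding a point mass evaluates the extension kernel \<open>eP n\<close> at that
    point.\<close>
  have "C 0 (Suc n) (\<lambda>_. undefined) = eP n (restrict p {0..<n})"
    using bind_return[OF measurable_eP r] by (simp only: C.simps Suc add_0)
  also have "\<dots> = return (PiM {0..<Suc n} M) ((restrict p {0..<n})(n := p n))"
    unfolding eP_def det using p by (intro distr_return) auto
  also have "(restrict p {0..<n})(n := p n) = restrict p {0..<Suc n}"
    by (auto simp: restrict_def fun_eq_iff)
  finally show ?case .
qed

text \<open>Fixing one coordinate is a cylinder event, whose probability is 1 by
  \<open>C_deterministic\<close>; countably many such events then hold simultaneously.\<close>

lemma AE_lim_deterministic:
  assumes p: "\<And>i. p i \<in> space (M i)"
    and det: "\<And>i. P i (restrict p {0..<i}) = return (M i) (p i)"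
    and sing: "\<And>i. {p i} \<in> sets (M i)"
  shows "AE w in PF.lim. w = p"
proof -
  interpret lim: prob_space PF.lim by (rule prob_space_lim)
  have "AE w in PF.lim. w t = p t" for t
  proof -
    let ?J = "{0..<Suc t}"
    let ?X = "{w \<in> space (PiM ?J M). w t \<in> {p t}}"
    have X[measurable]: "?X \<in> sets (PiM ?J M)"
    proof -
      have "(\<lambda>w. w t) \<in> PiM ?J M \<rightarrow>\<^sub>M M t"
        by (rule measurable_component_singleton) simp
      from measurable_sets[OF this sing[of t]] show ?thesis
        by (simp add: vimage_def Int_def conj_commute)
    qed
    have "emeasure PF.lim (PF.emb UNIV ?J ?X) = CI ?J ?X"
      by (rule lim) (use X in auto)
    also have "\<dots> = C 0 (Suc t) (\<lambda>_. undefined) (PF.emb ?J ?J ?X)"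
      by (rule emeasure_CI) (use X in auto)
    \<comment> \<open>The index set is already an initial segment, so the embedding changes
      nothing.\<close>
    also have "PF.emb ?J ?J ?X = ?X"
      using sets.sets_into_space[OF X] by (rule prod_emb_id[OF _, unfolded space_PiM[symmetric]])
    also have "C 0 (Suc t) (\<lambda>_. undefined) ?X = 1"
      unfolding C_deterministic[OF p det] emeasure_return[OF X] using p
      by (simp add: space_PiM)
    finally have "lim.prob (PF.emb UNIV ?J ?X) = 1"
      by (simp add: measure_def)
    then have "AE w in PF.lim. w \<in> PF.emb UNIV ?J ?X"
      by (intro lim.AE_prob_1)
    then show ?thesis
      by eventually_elim (auto simp: prod_emb_def)
  qed
  then have "AE w in PF.lim. \<forall>t. w t = p t"
    by (simp add: AE_all_countable)
  then show ?thesis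
    by (simp add: fun_eq_iff)
qed

end

section \<open>Path measures\<close>

lemma sets_path_measure [measurable_cong]:
  "sets (path_measure M d) = sets (PiM UNIV (\<lambda>_. count_space UNIV))"
proof -
  interpret Ionescu_Tulcea "\<lambda>t w. measure_pmf (step_pmf M d t w)" "\<lambda>_. count_space UNIV"
    by (rule Ionescu_Tulcea_step_pmf)
  show ?thesis
    unfolding path_measure_def by (rule PF.sets_lim)
qed

lemma space_path_measure [simp]: "space (path_measure M d) = UNIV"
  using sets_eq_imp_space_eq[OF sets_path_measure] by (simp add: space_PiM)

lemma prob_space_path_measure: "prob_space (path_measure M d)"
  unfolding path_measure_def
  by (rule Ionescu_Tulcea.prob_space_lim[OF Ionescu_Tulcea_step_pmf])

lemma AE_path_measure_deterministic:
  assumes "\<And>t. step_pmf M d t (restrict p {0..<t}) = return_pmf (p t)"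
  shows "AE w in path_measure M d. w = p"
  unfolding path_measure_def
  by (rule Ionescu_Tulcea.AE_lim_deterministic[OF Ionescu_Tulcea_step_pmf])
    (use assms in \<open>auto simp: return_pmf.rep_eq\<close>)

lemma measurable_coord_path_measure [measurable]:
  "(\<lambda>w. w t) \<in> path_measure M d \<rightarrow>\<^sub>M count_space UNIV"
  unfolding measurable_cong_sets[OF sets_path_measure refl]
  by (rule measurable_component_singleton) simp

lemma sets_reach [measurable]: "{w. \<exists>t. fst (w t) \<in> B} \<in> sets (path_measure M d)"
proof -
  have [measurable]: "Measurable.pred (path_measure M d) (\<lambda>w. fst (w t) \<in> B)" for t
    by (rule measurable_compose[OF measurable_coord_path_measure, of "\<lambda>x. fst x \<in> B"]) simp
  have "{w \<in> space (path_measure M d). \<exists>t. fst (w t) \<in> B} \<in> sets (path_measure M d)"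
    by measurable
  then show ?thesis by simp
qed

lemma reach_prob_le_1: "reach_prob M B d \<le> 1"
  unfolding reach_prob_def
  by (intro prob_space.prob_le_1 prob_space_path_measure)

lemma reach_prob_eq_1_iff:
  "reach_prob M B d = 1 \<longleftrightarrow> (AE w in path_measure M d. \<exists>t. fst (w t) \<in> B)"
  unfolding reach_prob_def
  using prob_space.prob_Collect_eq_1[OF prob_space_path_measure, of M d "\<lambda>w. \<exists>t. fst (w t) \<in> B"]
  by simp

text \<open>A single policy of value 1 pins the maximum at 1, the upper bound for any
  probability.\<close>

lemma max_reach_policies_eq_almost_sure:
  assumes "d\<^sub>0 \<in> policies M" "reach_prob M B d\<^sub>0 = 1"
  shows "max_reach_policies M B = {d \<in> policies M. reach_prob M B d = 1}"
proof -
  have "(\<forall>d'\<in>policies M. reach_prob M B d' \<le> reach_prob M B d) \<longleftrightarrow> reach_prob M B d = 1" for d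
    using assms reach_prob_le_1[of M B] by (metis antisym)
  then show ?thesis
    by (simp add: max_reach_policies_def)
qed

section \<open>Waiting before entering a costly target\<close>

text \<open>Action 0 stays and action 1 moves to the target; writing the successor as
  \<open>max s a\<close> makes state 1 absorbing under both actions.\<close>

definition wait_mdp :: "(nat, nat) mdp" where
  "wait_mdp = \<lparr>states = {0, 1}, init = 0, actions = {0, 1}, avail = (\<lambda>_. {0, 1}),
     trans_prob = (\<lambda>s a s'. of_bool (s' = max s a))\<rparr>"

definition target_cost :: "nat \<Rightarrow> nat \<Rightarrow> real" where
  "target_cost s a = of_bool (s = 1)"

definition wait_policy :: "nat \<Rightarrow> (nat, nat) policy" where
  "wait_policy n t s a = of_bool (a = of_bool (n \<le> t))"

text \<open>The state uses \<open><\<close> and the action \<le> because the move chosen at step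
  \<open>n\<close> shows in the state only at step \<open>Suc n\<close>.\<close>

definition wait_path :: "nat \<Rightarrow> nat \<Rightarrow> nat \<times> nat" where
  "wait_path n t = (of_bool (n < t), of_bool (n \<le> t))"

lemma finite_wait_mdp: "finite_mdp wait_mdp"
  by (auto simp: finite_mdp_def wait_mdp_def)

lemma init_wait_mdp: "init wait_mdp = 0"
  by (simp add: wait_mdp_def)

lemma wait_policy_in_policies: "wait_policy n \<in> policies wait_mdp"
  by (auto simp: policies_def wait_mdp_def wait_policy_def)

lemma next_pmf_wait_mdp:
  assumes "s \<in> {0, 1}" "a \<in> {0, 1}"
  shows "next_pmf wait_mdp s a = return_pmf (max s a)"
  using assms
  by (intro pmf_eqI, subst pmf_next_pmf[OF finite_wait_mdp])
    (auto simp: wait_mdp_def indicator_def)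

lemma action_pmf_wait_policy:
  assumes "s \<in> {0, 1}"
  shows "action_pmf wait_mdp (wait_policy n) t s = return_pmf (of_bool (n \<le> t))"
  using assms
  by (intro pmf_eqI, subst pmf_action_pmf[OF finite_wait_mdp wait_policy_in_policies])
    (auto simp: wait_mdp_def wait_policy_def indicator_def)

lemma step_pmf_wait_policy:
  "step_pmf wait_mdp (wait_policy n) t (restrict (wait_path n) {0..<t}) = return_pmf (wait_path n t)"
proof (cases t)
  case 0
  then show ?thesis
    by (simp add: step_pmf_def wait_path_def bind_return_pmf action_pmf_wait_policy init_wait_mdp)
next
  case (Suc k)
  then show ?thesis
    \<comment> \<open>The next state is the maximum of the truth values of \<open>n < k\<close> and
      \<open>n\<close> \<le> \<open>k\<close>, which is that of \<open>n < Suc k\<close>.\<close>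
    by (auto simp: step_pmf_def wait_path_def bind_return_pmf action_pmf_wait_policy
        next_pmf_wait_mdp)
qed

lemma AE_wait_path: "AE w in path_measure wait_mdp (wait_policy n). w = wait_path n"
  by (rule AE_path_measure_deterministic) (rule step_pmf_wait_policy)

lemma reach_prob_wait_policy: "reach_prob wait_mdp {1} (wait_policy n) = 1"
  unfolding reach_prob_eq_1_iff
  using AE_wait_path[of n] by eventually_elim (auto simp: wait_path_def intro: exI[of _ "Suc n"])

section \<open>Discounted cost along a single path\<close>

lemma summable_target_cost:
  "summable (\<lambda>t. (1 / 2) ^ t * target_cost (fst (w t)) (snd (w t)))"
  by (rule summable_comparison_test'[of "\<lambda>t. (1 / 2 :: real) ^ t" 0])
    (auto simp: target_cost_def)

lemma suminf_target_cost_le: "(\<Sum>t. (1 / 2) ^ t * target_cost (fst (w t)) (snd (w t))) \<le> 2"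
proof -
  have "(\<Sum>t. (1 / 2) ^ t * target_cost (fst (w t)) (snd (w t))) \<le> (\<Sum>t. (1 / 2 :: real) ^ t)"
    by (intro suminf_le summable_target_cost) (auto simp: target_cost_def)
  then show ?thesis by (simp add: suminf_geometric)
qed

lemma suminf_target_cost_nonneg:
  "0 \<le> (\<Sum>t. (1 / 2) ^ t * target_cost (fst (w t)) (snd (w t)))"
  by (intro suminf_nonneg summable_target_cost) (auto simp: target_cost_def)

lemma suminf_target_cost_pos:
  assumes "fst (w i) = 1"
  shows "0 < (\<Sum>t. (1 / 2) ^ t * target_cost (fst (w t)) (snd (w t)))"
  by (intro suminf_pos2[of _ i] summable_target_cost) (use assms in \<open>auto simp: target_cost_def\<close>)

text \<open>The first \<open>Suc n\<close> terms vanish, and the geometric tail from step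
  \<open>Suc n\<close> on sums to twice its first term \<open>(1 / 2) ^ Suc n\<close>.\<close>

lemma suminf_target_cost_wait_path:
  "(\<Sum>t. (1 / 2) ^ t * target_cost (fst (wait_path n t)) (snd (wait_path n t))) = (1 / 2) ^ n"
proof -
  let ?g = "\<lambda>t. (1 / 2) ^ t * target_cost (fst (wait_path n t)) (snd (wait_path n t))"
  have "(\<lambda>t. (1 / 2 :: real) ^ Suc n * (1 / 2) ^ t) sums ((1 / 2) ^ Suc n * 2)"
    using geometric_sums[of "1 / 2 :: real"] by (intro sums_mult) simp
  then have "(\<lambda>t. ?g (t + Suc n)) sums (1 / 2) ^ n"
    by (simp add: wait_path_def target_cost_def power_add mult_ac)
  then have "?g sums (1 / 2) ^ n"
    by (subst (asm) sums_zero_iff_shift) (auto simp: wait_path_def target_cost_def)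
  then show ?thesis by (rule sums_unique[symmetric])
qed

section \<open>Expected discounted cost\<close>

lemma borel_measurable_suminf_target_cost [measurable]:
  "(\<lambda>w. \<Sum>t. (1 / 2) ^ t * target_cost (fst (w t)) (snd (w t)))
    \<in> borel_measurable (path_measure M d)"
proof -
  have [measurable]: "(\<lambda>w. target_cost (fst (w t)) (snd (w t))) \<in> borel_measurable (path_measure M d)"
    for t
    by (rule measurable_compose[OF measurable_coord_path_measure,
          of "\<lambda>x. target_cost (fst x) (snd x)"]) simp
  show ?thesis by measurable
qed

text \<open>Integrability ensures that a zero expectation is genuine and not the default value of
  the integral, as the positivity argument requires.\<close>

lemma integrable_suminf_target_cost:
  "integrable (path_measure M d) (\<lambda>w. \<Sum>t. (1 / 2) ^ t * target_cost (fst (w t)) (snd (w t)))"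
proof -
  interpret prob_space "path_measure M d" by (rule prob_space_path_measure)
  show ?thesis
    by (rule integrable_const_bound[of _ 2])
      (auto simp: suminf_target_cost_nonneg suminf_target_cost_le)
qed

lemma cost_to_go_target_nonneg: "0 \<le> cost_to_go M target_cost (1 / 2) d"
  unfolding cost_to_go_def by (intro integral_nonneg_AE) (simp add: suminf_target_cost_nonneg)

text \<open>A nonnegative cost with zero expectation would vanish almost surely, yet almost every
  path visits the target and pays there.\<close>

lemma cost_to_go_target_pos:
  assumes "reach_prob M {1} d = 1"
  shows "0 < cost_to_go M target_cost (1 / 2) d"
proof (rule ccontr)
  interpret prob_space "path_measure M d" by (rule prob_space_path_measure)
  let ?f = "\<lambda>w. \<Sum>t. (1 / 2) ^ t * target_cost (fst (w t)) (snd (w t))"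
  assume "\<not> ?thesis"
  then have "(\<integral>w. ?f w \<partial>path_measure M d) = 0"
    using cost_to_go_target_nonneg[of M d] by (simp add: cost_to_go_def)
  then have "AE w in path_measure M d. ?f w = 0"
    by (subst (asm) integral_nonneg_eq_0_iff_AE[OF integrable_suminf_target_cost])
      (simp_all add: suminf_target_cost_nonneg)
  moreover have "AE w in path_measure M d. \<exists>t. fst (w t) \<in> {1}"
    using assms by (simp only: reach_prob_eq_1_iff)
  ultimately have "AE w in path_measure M d. False"
  proof eventually_elim
    case (elim w)
    then obtain i where "fst (w i) = 1" by auto
    from suminf_target_cost_pos[of w, OF this] elim(1) show ?case by linarith
  qed
  then show False by simp
qed

lemma cost_to_go_wait_policy: "cost_to_go wait_mdp target_cost (1 / 2) (wait_policy n) = (1 / 2) ^ n"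
proof -
  interpret prob_space "path_measure wait_mdp (wait_policy n)" by (rule prob_space_path_measure)
  have "cost_to_go wait_mdp target_cost (1 / 2) (wait_policy n) =
      (\<integral>w. (1 / 2) ^ n \<partial>path_measure wait_mdp (wait_policy n))"
    unfolding cost_to_go_def
    by (rule integral_cong_AE)
      (use AE_wait_path[of n] in \<open>auto elim!: eventually_mono simp: suminf_target_cost_wait_path\<close>)
  then show ?thesis by (simp add: prob_space[simplified])
qed

theorem mainTheorem1:
  shows "\<exists>(M :: (nat, nat) mdp) (c :: nat \<Rightarrow> nat \<Rightarrow> real) (\<beta> :: real) (B :: nat set).
    finite_mdp M \<and>
    (\<forall>s\<in>states M. \<forall>a\<in>actions M. 0 \<le> c s a) \<and>
    0 < \<beta> \<and> \<beta> < 1 \<and>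
    B \<subseteq> states M \<and> (\<forall>s\<in>B. absorbing M s) \<and>
    \<not> (\<exists>d\<in>max_reach_policies M B.
          cost_to_go M c \<beta> d = (INF d'\<in>max_reach_policies M B. cost_to_go M c \<beta> d'))"
proof -
  let ?J = "cost_to_go wait_mdp target_cost (1 / 2)"
  let ?X = "max_reach_policies wait_mdp {1}"
  have X: "?X = {d \<in> policies wait_mdp. reach_prob wait_mdp {1} d = 1}"
    by (rule max_reach_policies_eq_almost_sure[OF wait_policy_in_policies reach_prob_wait_policy])
  have "?J d \<noteq> (INF d'\<in>?X. ?J d')" if "d \<in> ?X" for d
  proof -
    have "0 < ?J d"
      using that by (intro cost_to_go_target_pos) (simp only: X mem_Collect_eq)
    \<comment> \<open>Waiting \<open>n\<close> steps is strictly cheaper than \<open>d\<close>, so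
      \<open>d\<close> cannot attain the infimum.\<close>
    then obtain n where n: "(1 / 2) ^ n < ?J d"
      using real_arch_pow_inv[of "?J d" "1 / 2"] by auto
    have "(INF d'\<in>?X. ?J d') \<le> ?J (wait_policy n)"
    proof (rule cINF_lower)
      \<comment> \<open>The infimum is taken in the reals, where it is a lower bound only for sets
        bounded below.\<close>
      show "bdd_below (?J ` ?X)"
        by (rule bdd_belowI2) (rule cost_to_go_target_nonneg)
      show "wait_policy n \<in> ?X"
        unfolding X using wait_policy_in_policies reach_prob_wait_policy by blast
    qed
    with n show ?thesis
      by (simp add: cost_to_go_wait_policy)
  qed
  then show ?thesis
    by (intro exI[of _ wait_mdp] exI[of _ target_cost] exI[of _ "1 / 2"] exI[of _ "{1}"])
      (auto simp: finite_wait_mdp target_cost_def absorbing_def, auto simp: wait_mdp_def)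
qed

end
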